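(* Let $m\ge 2$ be an integer with $\omega(m)=4$. Then either $m$ is odd and every divisor $d>1$ of $m$ satisfies $\omega(d)=4$, or $m=2n$ where $n$ is odd and every divisor $d>1$ of $n$ satisfies $\omega(d)=4$.
   Context: $F_n$ denotes the Fibonacci sequence: $F_0=0$, $F_1=1$, $F_n=F_{n-1}+F_{n-2}$. For an integer $m\ge 2$, the Pisano period $\pi(m)$ is the least positive period of $(F_n \bmod m)$, and $\omega(m)$ is the number of indices $0\le n<\pi(m)$ with $m\mid F_n$. *)

theory Defs
  imports "HOL-Number_Theory.Number_Theory"
begin

text \<open>
  The Fibonacci numbers \<open>fib\<close> of the library satisfy \<open>fib 0 = 0\<close>, \<open>fib 1 = 1\<close>.
\<close>

text \<open>
  For \<open>m \<ge> 2\<close> the sequence of residues is purely periodic, so the \<open>LEAST\<close> below is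
  attained; the value at \<open>m = 0\<close> is junk.
\<close>
definition pisano :: "nat \<Rightarrow> nat" where
  "pisano m = (LEAST p. p > 0 \<and> (\<forall>n. fib (n + p) mod m = fib n mod m))"

definition pisano_zeros :: "nat \<Rightarrow> nat" where
  "pisano_zeros m = card {n. n < pisano m \<and> m dvd fib n}"

end

theory Submission
  imports Defs
begin

text \<open>
  Let \<open>a\<close> be the rank of apparition of \<open>m\<close> and \<open>\<beta> = fib (a + 1)\<close>. Shifting indices by \<open>a\<close>
  multiplies the Fibonacci sequence by \<open>\<beta>\<close> modulo \<open>m\<close>, so \<open>\<omega>(m)\<close> is the multiplicative
  order of \<open>\<beta>\<close>. Cassini's identity gives \<open>\<beta>\<^sup>2 \<equiv> (-1)\<^sup>a\<close>; hence, for \<open>m > 2\<close>, \<open>\<omega>(m) = 4\<close>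
  iff \<open>a\<close> is odd, i.e. iff \<open>m\<close> divides some \<open>fib k\<close> with \<open>k\<close> odd, a property inherited by
  divisors of \<open>m\<close>. It fails for \<open>4\<close>, whose rank is \<open>6\<close>.
\<close>

definition fib_rank :: "nat \<Rightarrow> nat" where
  "fib_rank m = (LEAST n. n > 0 \<and> m dvd fib n)"

lemma fib_rank:
  assumes "k > 0" "m dvd fib k"
  shows "fib_rank m > 0" "m dvd fib (fib_rank m)"
  using LeastI[of "\<lambda>n. n > 0 \<and> m dvd fib n" k] assms unfolding fib_rank_def by auto

text \<open>\<open>fib_gcd\<close> puts \<open>gcd (fib_rank m) n\<close> among the indices where
  \<open>m\<close> divides; minimality of the rank then forces this gcd to be the rank
  itself.\<close>

lemma dvd_fib_iff:
  assumes "k > 0" "m dvd fib k"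
  shows "m dvd fib n \<longleftrightarrow> fib_rank m dvd n"
proof
  let ?g = "gcd (fib_rank m) n"
  assume "m dvd fib n"
  with fib_rank[OF assms] have "m dvd fib ?g" "?g > 0"
    by (simp_all add: fib_gcd)
  then have "fib_rank m \<le> ?g"
    unfolding fib_rank_def[of m] by (intro Least_le) (simp add: fib_rank_def)
  moreover have "?g \<le> fib_rank m"
    using fib_rank[OF assms] by (intro dvd_imp_le) auto
  ultimately show "fib_rank m dvd n"
    by (metis gcd_dvd2 le_antisym)
next
  assume "fib_rank m dvd n"
  then have "fib (fib_rank m) dvd fib n"
    by (metis fib_gcd gcd_dvd2 gcd_nat.absorb1)
  with fib_rank[OF assms] show "m dvd fib n"
    by (blast intro: dvd_trans)
qed

text \<open>In the addition formula for \<open>fib (l + a + 1)\<close> the term with factor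
  \<open>fib a\<close> vanishes modulo \<open>m\<close>; iterating gives the power.\<close>

lemma cong_fib_shift:
  assumes "m dvd fib a"
  shows "[fib (n + j * a) = fib (Suc a) ^ j * fib n] (mod m)"
proof (induction j)
  case (Suc j)
  have shift: "[fib (k + a) = fib (Suc a) * fib k] (mod m)" for k
  proof (cases k)
    case (Suc l)
    then have "fib (k + a) = fib (Suc a) * fib k + fib a * fib l"
      using fib_add[of a l] by (simp add: algebra_simps)
    moreover have "[fib (Suc a) * fib k + fib a * fib l = fib (Suc a) * fib k + 0] (mod m)"
      by (intro cong_add cong_refl) (use assms in \<open>simp add: cong_0_iff\<close>)
    ultimately show ?thesis
      by simp
  qed (use assms in \<open>simp add: cong_0_iff\<close>)
  have "[fib (n + Suc j * a) = fib (Suc a) * fib (n + j * a)] (mod m)"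
    using shift[of "n + j * a"] by (simp add: algebra_simps)
  also have "[fib (Suc a) * fib (n + j * a) = fib (Suc a) * (fib (Suc a) ^ j * fib n)] (mod m)"
    using Suc.IH by (rule cong_scalar_left)
  finally show ?case
    by (simp add: mult.assoc)
qed simp

lemma pisano_zeros_eq_ord:
  assumes "k > 0" "m dvd fib k"
  shows "pisano_zeros m = ord m (fib (Suc (fib_rank m)))"
proof -
  define a b where "a = fib_rank m" and "b = fib (Suc a)"
  have a: "a > 0" "m dvd fib a"
    using fib_rank[OF assms] by (simp_all add: a_def)
  have dvd: "m dvd fib n \<longleftrightarrow> a dvd n" for n
    using dvd_fib_iff[OF assms] by (simp add: a_def)
  \<comment> \<open>Consecutive Fibonacci numbers are coprime, so \<open>b\<close> is a unit modulo
    \<open>m\<close> and its order is not the default value 0.\<close>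
  have "coprime m b"
    using a(2) coprime_fib_Suc_nat[of a] unfolding b_def
    by (metis coprime_divisors dvd_refl)
  then have r: "ord m b > 0"
    by (simp add: ord_eq_0)
  have period: "(\<forall>n. fib (n + p) mod m = fib n mod m) \<longleftrightarrow> a * ord m b dvd p" for p
  proof
    assume p: "\<forall>n. fib (n + p) mod m = fib n mod m"
    \<comment> \<open>Index 0 makes \<open>p\<close> a multiple of \<open>a\<close>; index 1, where
      \<open>fib 1 = 1\<close>, then isolates \<open>b ^ j\<close>.\<close>
    from p[rule_format, of 0] have "a dvd p"
      using dvd[of p] by auto
    then obtain j where j: "p = j * a"
      by (metis dvdE mult.commute)
    have "[b ^ j = 1] (mod m)"
      using p[rule_format, of 1] cong_fib_shift[OF a(2), of 1 j] by (simp add: j b_def cong_def)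
    then show "a * ord m b dvd p"
      by (simp add: j ord_divides' mult.commute)
  next
    assume "a * ord m b dvd p"
    then obtain j where j: "p = j * a" "ord m b dvd j"
      by (metis dvdE dvd_triv_left mult.assoc mult.commute)
    then have "[b ^ j = 1] (mod m)"
      by (simp add: ord_divides')
    then show "\<forall>n. fib (n + p) mod m = fib n mod m"
      using cong_fib_shift[OF a(2)] unfolding j b_def
      by (metis cong_def cong_scalar_right mult_1)
  qed
  have "pisano m = a * ord m b"
    unfolding pisano_def period
    by (rule Least_equality) (use a(1) r in \<open>auto intro: dvd_imp_le\<close>)
  then have "{n. n < pisano m \<and> m dvd fib n} = (\<lambda>i. a * i) ` {..<ord m b}"
    using a(1) by (auto simp: dvd)
  then show ?thesis
    using a(1) by (simp add: pisano_zeros_def card_image inj_on_def a_def b_def)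
qed

text \<open>Cassini's identity writes the difference of the two sides as
  \<open>fib a * fib (a + 2)\<close>.\<close>

lemma cong_fib_Suc_square:
  assumes "m dvd fib a"
  shows "[int (fib (Suc a)) ^ 2 = (-1) ^ a] (mod int m)"
proof -
  have "int m dvd int (fib a)"
    using assms by simp
  moreover have "int (fib (Suc a)) ^ 2 - (-1) ^ a = int (fib a) * int (fib (Suc a) + fib a)"
    using fib_Cassini_int[of a] by (simp add: power2_eq_square algebra_simps)
  ultimately show ?thesis
    by (simp add: cong_iff_dvd_diff)
qed

lemma pisano_zeros_eq_4_iff:
  assumes "k > 0" "m dvd fib k" "m > 2"
  shows "pisano_zeros m = 4 \<longleftrightarrow> odd (fib_rank m)"
proof -
  define a b where "a = fib_rank m" and "b = fib (Suc a)"
  have sq: "[int b ^ 2 = (-1) ^ a] (mod int m)"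
    unfolding a_def b_def by (rule cong_fib_Suc_square) (rule fib_rank[OF assms(1,2)])
  have ord: "ord m b dvd j \<longleftrightarrow> [int b ^ j = 1] (mod int m)" for j
    using ord_divides[of b j m] cong_int_iff[of "b ^ j" 1 m] by simp
  have "ord m b = 4 \<longleftrightarrow> odd a"
  proof (cases "even a")
    case True
    with sq have "ord m b dvd 2"
      by (simp add: ord)
    with True show ?thesis
      by (auto dest: dvd_imp_le)
  next
    case False
    with sq have sq': "[int b ^ 2 = -1] (mod int m)"
      by simp
    \<comment> \<open>Here \<open>m > 2\<close> matters: it keeps -1 and 1 distinct modulo
      \<open>m\<close>.\<close>
    have "\<not> ord m b dvd 2"
    proof
      assume "ord m b dvd 2"
      with sq' have "[- 1 = 1] (mod int m)"
        unfolding ord by (metis cong_sym cong_trans)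
      with assms(3) show False
        by (auto simp: cong_iff_dvd_diff dest: zdvd_imp_le)
    qed
    moreover have "ord m b dvd 4"
      using cong_pow[OF sq', of 2] by (simp add: ord flip: power_mult)
    then have "ord m b dvd 2 ^ 2"
      by simp
    then obtain i where "i \<le> 2" "ord m b = 2 ^ i"
      using divides_primepow_nat[OF two_is_prime_nat] by blast
    ultimately have "i = 2"
      using le_imp_power_dvd[of i 1 "2::nat"] by (cases "i \<le> 1") auto
    with False \<open>ord m b = 2 ^ i\<close> show ?thesis
      by simp
  qed
  with pisano_zeros_eq_ord[OF assms(1,2)] show ?thesis
    by (simp add: a_def b_def)
qed

text \<open>In this form the criterion passes to divisors by transitivity of divisibility.\<close>

lemma pisano_zeros_eq_4_iff_odd:
  assumes "m > 2"
  shows "pisano_zeros m = 4 \<longleftrightarrow> (\<exists>k. odd k \<and> m dvd fib k)"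
proof
  assume m: "pisano_zeros m = 4"
  \<comment> \<open>Four zeros cannot all sit at index 0, which yields the positive index that the
    rank lemmas require.\<close>
  have "\<not> {n. n < pisano m \<and> m dvd fib n} \<subseteq> {0}"
  proof
    assume "{n. n < pisano m \<and> m dvd fib n} \<subseteq> {0}"
    from card_mono[OF _ this] m show False
      by (simp add: pisano_zeros_def)
  qed
  then obtain k where k: "k > 0" "m dvd fib k"
    by auto
  with m assms show "\<exists>k. odd k \<and> m dvd fib k"
    using pisano_zeros_eq_4_iff fib_rank by blast
next
  assume "\<exists>k. odd k \<and> m dvd fib k"
  then obtain k where k: "odd k" "m dvd fib k"
    by blast
  then have "k > 0"
    by (simp add: odd_pos)
  moreover from this k have "odd (fib_rank m)"
    using dvd_fib_iff by (metis dvd_trans)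
  ultimately show "pisano_zeros m = 4"
    using k assms pisano_zeros_eq_4_iff by blast
qed

text \<open>Orders modulo 2 divide \<open>totient 2 = 1\<close>, or are 0 for non-units;
  \<open>fib 3 = 2\<close> shows that the rank exists.\<close>

lemma pisano_zeros_2_le: "pisano_zeros 2 \<le> 1"
proof -
  have "ord 2 b \<le> 1" for b :: nat
    using order_divides_totient[of 2 b] by (cases "coprime 2 b") (auto simp: ord_eq_0)
  then show ?thesis
    using pisano_zeros_eq_ord[of 3 2] by (simp add: numeral_eq_Suc)
qed

text \<open>Since 4 divides \<open>fib 6 = 8\<close>, it divides \<open>fib (gcd k 6)\<close>; for
  odd \<open>k\<close> the gcd divides 3, and this value is at most
  \<open>fib 3 = 2\<close>.\<close>

lemma four_dvd_fib_imp_even: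
  assumes "4 dvd fib k"
  shows "even k"
proof (rule ccontr)
  assume "odd k"
  then have "coprime (gcd k 6) 2"
    by (simp add: coprime_right_2_iff_odd)
  moreover have "gcd k 6 dvd 3 * 2"
    by simp
  ultimately have "gcd k 6 dvd 3"
    using coprime_dvd_mult_left_iff by blast
  then have "fib (gcd k 6) \<le> fib 3"
    by (intro fib_mono dvd_imp_le) auto
  moreover have "fib 6 = 4 * 2"
    by (simp add: numeral_eq_Suc)
  then have "4 dvd fib (gcd k 6)"
    using assms by (simp add: fib_gcd)
  then have "4 \<le> fib (gcd k 6)"
    by (intro dvd_imp_le fib_neq_0_nat) auto
  ultimately show False
    by (simp add: numeral_eq_Suc)
qed

theorem theorem2p10:
  fixes m :: nat
  assumes "m \<ge> 2" and "pisano_zeros m = 4"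
  shows "(odd m \<and> (\<forall>d. d dvd m \<and> d > 1 \<longrightarrow> pisano_zeros d = 4)) \<or>
         (\<exists>n. m = 2 * n \<and> odd n \<and> (\<forall>d. d dvd n \<and> d > 1 \<longrightarrow> pisano_zeros d = 4))"
proof -
  have "m > 2"
    using assms pisano_zeros_2_le by (cases "m = 2") auto
  with assms(2) obtain k where k: "odd k" "m dvd fib k"
    using pisano_zeros_eq_4_iff_odd by blast
  \<comment> \<open>Oddness excludes \<open>d = 2\<close>, the one divisor above 1 outside the range
    of the criterion.\<close>
  have *: "pisano_zeros d = 4" if "d dvd m" "odd d" "d > 1" for d
  proof -
    have "d > 2"
      using that by (cases "d = 2") auto
    with k that(1) show ?thesis
      using pisano_zeros_eq_4_iff_odd by (metis dvd_trans)
  qed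
  show ?thesis
  proof (cases "even m")
    case True
    then obtain n where n: "m = 2 * n"
      by blast
    have "odd n"
    proof
      assume "even n"
      then have "4 dvd m"
        by (auto simp: n elim!: evenE)
      with k show False
        using four_dvd_fib_imp_even by (metis dvd_trans)
    qed
    with n * show ?thesis
      by (metis dvd_mult dvd_trans)
  next
    case False
    with * show ?thesis
      by (metis dvd_trans)
  qed
qed

end
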